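(* Consider a hybrid array with $M\ge 1$ analog subarrays as described in the context, in either the non-coherent or the coherent beamforming (BF) mode, and let $t$ be a fixed transmit duration with $t_{\min}\le t\le T$. Let $\pi$ be a permutation of $\{1,\dots,M\}$ with $\kappa_{\pi(1)}\ge\kappa_{\pi(2)}\ge\cdots\ge\kappa_{\pi(M)}$. Let $m^*\in\{1,\dots,M\}$ be the index specified by $$\begin{cases}\displaystyle\sum_{m=1}^{m^*-1}P_{\max}^2\kappa_{\pi(m)}^2<\theta(t)\le\sum_{m=1}^{m^*}P_{\max}^2\kappa_{\pi(m)}^2, & \text{non-coherent BF},\\[2mm] \displaystyle\sum_{m=1}^{m^*-1}P_{\max}\kappa_{\pi(m)}<\sqrt{\theta(t)}\le\sum_{m=1}^{m^*}P_{\max}\kappa_{\pi(m)}, & \text{coherent BF},\end{cases}$$ where empty sums (the case $m^*=1$) are $0$. Define $p^*=(p_1^*,\dots,p_M^* )$ by $$p^*_{\pi(m)}=P_{\max}\eta_{\max}^2\quad\text{for } m\in\{1,\dots,m^*-1\},$$ $$p^*_{\pi(m^* )}=\begin{cases}\dfrac{\theta(t)-\sum_{m=1}^{m^*-1}P_{\max}^2\kappa_{\pi(m)}^2}{h_{\pi(m^* )}^2}, & \text{non-coherent BF},\\[3mm] \dfrac{\left(\sqrt{\theta(t)}-\sum_{m=1}^{m^*-1}P_{\max}\kappa_{\pi(m)}\right)^2}{h_{\pi(m^* )}^2}, & \text{coherent BF},\end{cases}$$ $$p^*_{\pi(m)}=0\quad\text{for } m\in\{m^*+1,\dots,M\}.$$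 Then, for the given $t$, the energy efficiency of the hybrid array is maximized by turning on only the subarrays $\pi(1),\dots,\pi(m^* )$ with the transmit powers $p^*$; that is, $p^*$ is feasible for the given $t$ and $E(p^*,t)\le E(p,t)$ (equivalently, $\eta_E(p^*,t)\ge\eta_E(p,t)$) for every power vector $p$ that is feasible for the given $t$.
   Context: Parameters: slot duration $T>0$, bandwidth $W>0$, noise power $\sigma^2>0$, target average data rate $r_{\rm dl}>0$, maximum output power $P_{\max}>0$, maximum power amplifier efficiency $\eta_{\max}>0$, rate-dependent circuit power coefficient $\epsilon\ge 0$, static circuit power $P_{\rm base}$ in transmit mode and circuit power $P_{\rm idle}>0$ in idle mode, with $P_{\rm base}\ge P_{\rm idle}$. Subarray $m\in\{1,\dots,M\}$ has equivalent channel gain $h_m>0$ and effective channel gain $$\kappa_m=\frac{\eta_{\max}}{\sqrt{P_{\max}}}\,h_m>0 .$$ The variables are the subarray transmit powers $p=(p_1,\dots,p_M)$ with $p_m\ge 0$. The power consumed by the (non-ideal) power amplifiers of subarray $m$ is $\Psi(p_m)=\sqrt{p_mP_{\max}}/\eta_{\max}$. The received power is $$S(p)=\begin{cases}\sum_{m=1}^M p_m h_m^2, & \text{non-coherent BF},\\ \left(\sum_{m=1}^M\sqrt{p_m}\,h_m\right)^2, & \text{coherent BF}.\end{cases}$$ The instantaneous rate is $R_a(p)=W\log_2(1+S(p)/\sigma^2)$ and the average rate over a slot with transmit duration $t$ is $R(p,t)=\frac tT R_a(p)$. A subarray is active (turned on) if $p_m>0$. Each active subarray consumes power $P_{{\rm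 tx},m}=\Psi(p_m)+\epsilon R_a(p)+P_{\rm base}$ for $t$ seconds and $P_{\rm idle}$ for the remaining $T-t$ seconds; each inactive subarray consumes $P_{\rm idle}$ during the whole slot. With $\mathbb I(x)=1$ if $x>0$ and $\mathbb I(x)=0$ otherwise, the total energy consumption is $$E(p,t)=\sum_{m=1}^M\mathbb I(p_m)\big[P_{{\rm tx},m}\,t+P_{\rm idle}(T-t)\big]+\sum_{m=1}^M\big[1-\mathbb I(p_m)\big]P_{\rm idle}T ,$$ and the energy efficiency (EE) is $\eta_E(p,t)=r_{\rm dl}T/E(p,t)$. For given $t$, a vector $p$ is feasible if $R(p,t)\ge r_{\rm dl}$ and $0\le\Psi(p_m)\le P_{\max}$ for all $m$. Define $$\theta(t)=\left(2^{\frac{r_{\rm dl}T}{tW}}-1\right)\sigma^2>0 .$$ $t_{\min}$ denotes the minimum transmit duration $t>0$ for which a feasible $p$ exists; it is assumed that $t_{\min}\le T$. Equivalently, $t\ge t_{\min}$ means $\theta(t)\le\sum_{m=1}^M P_{\max}^2\kappa_m^2$ (non-coherent BF), respectively $\sqrt{\theta(t)}\le\sum_{m=1}^M P_{\max}\kappa_m$ (coherent BF). *)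

theory Defs
  imports Complex_Main "HOL-Combinatorics.Permutations"
begin

datatype bf_mode = Noncoherent | Coherent

(* Subarrays are indexed by {1..num_sub}; values of channel_gain and of a power vector
   p :: nat => real outside this range are irrelevant.
   noise_power is the quantity written sigma^2. *)
record hybrid_array =
  num_sub :: nat
  slot :: real
  bandwidth :: real
  noise_power :: real
  target_rate :: real
  power_max :: real
  eff_max :: real
  rate_coeff :: real
  power_base :: real
  power_idle :: real
  channel_gain :: "nat \<Rightarrow> real"

definition subarrays :: "hybrid_array \<Rightarrow> nat set" where
  "subarrays A = {1..num_sub A}"

definition valid_array :: "hybrid_array \<Rightarrow> bool" where
  "valid_array A \<longleftrightarrow>
     num_sub A \<ge> 1 \<and> slot A > 0 \<and> bandwidth A > 0 \<and> noise_power A > 0 \<and> target_rate A > 0 \<and>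
     power_max A > 0 \<and> eff_max A > 0 \<and> rate_coeff A \<ge> 0 \<and>
     power_idle A > 0 \<and> power_base A \<ge> power_idle A \<and>
     (\<forall>m\<in>subarrays A. channel_gain A m > 0)"

definition eff_gain :: "hybrid_array \<Rightarrow> nat \<Rightarrow> real" where
  "eff_gain A m = eff_max A / sqrt (power_max A) * channel_gain A m"

definition pa_power :: "hybrid_array \<Rightarrow> real \<Rightarrow> real" where
  "pa_power A x = sqrt (x * power_max A) / eff_max A"

fun received_power :: "hybrid_array \<Rightarrow> bf_mode \<Rightarrow> (nat \<Rightarrow> real) \<Rightarrow> real" where
  "received_power A Noncoherent p = (\<Sum>m\<in>subarrays A. p m * (channel_gain A m)\<^sup>2)"
| "received_power A Coherent p = (\<Sum>m\<in>subarrays A. sqrt (p m) * channel_gain A m)\<^sup>2"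

definition inst_rate :: "hybrid_array \<Rightarrow> bf_mode \<Rightarrow> (nat \<Rightarrow> real) \<Rightarrow> real" where
  "inst_rate A b p = bandwidth A * log 2 (1 + received_power A b p / noise_power A)"

definition avg_rate :: "hybrid_array \<Rightarrow> bf_mode \<Rightarrow> (nat \<Rightarrow> real) \<Rightarrow> real \<Rightarrow> real" where
  "avg_rate A b p t = t / slot A * inst_rate A b p"

definition tx_power :: "hybrid_array \<Rightarrow> bf_mode \<Rightarrow> (nat \<Rightarrow> real) \<Rightarrow> nat \<Rightarrow> real" where
  "tx_power A b p m = pa_power A (p m) + rate_coeff A * inst_rate A b p + power_base A"

definition total_energy :: "hybrid_array \<Rightarrow> bf_mode \<Rightarrow> (nat \<Rightarrow> real) \<Rightarrow> real \<Rightarrow> real" where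
  "total_energy A b p t =
     (\<Sum>m\<in>subarrays A. of_bool (p m > 0) * (tx_power A b p m * t + power_idle A * (slot A - t))) +
     (\<Sum>m\<in>subarrays A. (1 - of_bool (p m > 0)) * (power_idle A * slot A))"

definition energy_efficiency :: "hybrid_array \<Rightarrow> bf_mode \<Rightarrow> (nat \<Rightarrow> real) \<Rightarrow> real \<Rightarrow> real" where
  "energy_efficiency A b p t = target_rate A * slot A / total_energy A b p t"

definition feasible :: "hybrid_array \<Rightarrow> bf_mode \<Rightarrow> real \<Rightarrow> (nat \<Rightarrow> real) \<Rightarrow> bool" where
  "feasible A b t p \<longleftrightarrow>
     avg_rate A b p t \<ge> target_rate A \<and>
     (\<forall>m\<in>subarrays A. p m \<ge> 0 \<and> 0 \<le> pa_power A (p m) \<and> pa_power A (p m) \<le> power_max A)"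

(* The minimum is attained for every valid array: some p is feasible for t > 0 iff all
   amplifiers at full power reach the target rate, i.e. iff t is at least a positive threshold. *)
definition t_min :: "hybrid_array \<Rightarrow> bf_mode \<Rightarrow> real" where
  "t_min A b = (LEAST t. t > 0 \<and> (\<exists>p. feasible A b t p))"

definition theta :: "hybrid_array \<Rightarrow> real \<Rightarrow> real" where
  "theta A t =
     (2 powr (target_rate A * slot A / (t * bandwidth A)) - 1) * noise_power A"

definition sorting_perm :: "hybrid_array \<Rightarrow> (nat \<Rightarrow> nat) \<Rightarrow> bool" where
  "sorting_perm A \<pi> \<longleftrightarrow>
     \<pi> permutes subarrays A \<and>
     (\<forall>i\<in>subarrays A. \<forall>j\<in>subarrays A. i \<le> j \<longrightarrow> eff_gain A (\<pi> j) \<le> eff_gain A (\<pi> i))"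

fun critical_index :: "hybrid_array \<Rightarrow> bf_mode \<Rightarrow> real \<Rightarrow> (nat \<Rightarrow> nat) \<Rightarrow> nat \<Rightarrow> bool" where
  "critical_index A Noncoherent t \<pi> k \<longleftrightarrow>
     k \<in> subarrays A \<and>
     (\<Sum>m\<in>{1..<k}. (power_max A)\<^sup>2 * (eff_gain A (\<pi> m))\<^sup>2) < theta A t \<and>
     theta A t \<le> (\<Sum>m\<in>{1..k}. (power_max A)\<^sup>2 * (eff_gain A (\<pi> m))\<^sup>2)"
| "critical_index A Coherent t \<pi> k \<longleftrightarrow>
     k \<in> subarrays A \<and>
     (\<Sum>m\<in>{1..<k}. power_max A * eff_gain A (\<pi> m)) < sqrt (theta A t) \<and>
     sqrt (theta A t) \<le> (\<Sum>m\<in>{1..k}. power_max A * eff_gain A (\<pi> m))"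

fun critical_power :: "hybrid_array \<Rightarrow> bf_mode \<Rightarrow> real \<Rightarrow> (nat \<Rightarrow> nat) \<Rightarrow> nat \<Rightarrow> real" where
  "critical_power A Noncoherent t \<pi> k =
     (theta A t - (\<Sum>m\<in>{1..<k}. (power_max A)\<^sup>2 * (eff_gain A (\<pi> m))\<^sup>2))
       / (channel_gain A (\<pi> k))\<^sup>2"
| "critical_power A Coherent t \<pi> k =
     (sqrt (theta A t) - (\<Sum>m\<in>{1..<k}. power_max A * eff_gain A (\<pi> m)))\<^sup>2
       / (channel_gain A (\<pi> k))\<^sup>2"

(* For subarray i, the number inv \<pi> i is its rank in the sorted order, so that the value
   at \<pi> m is given by the rank m. *)
definition p_star ::
  "hybrid_array \<Rightarrow> bf_mode \<Rightarrow> real \<Rightarrow> (nat \<Rightarrow> nat) \<Rightarrow> nat \<Rightarrow> nat \<Rightarrow> real" where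
  "p_star A b t \<pi> k i =
     (let m = inv \<pi> i in
      if m < k then power_max A * (eff_max A)\<^sup>2
      else if m = k then critical_power A b t \<pi> k
      else 0)"

definition active_set :: "hybrid_array \<Rightarrow> (nat \<Rightarrow> real) \<Rightarrow> nat set" where
  "active_set A p = {m \<in> subarrays A. p m > 0}"

end

theory Submission
  imports Defs
begin

text \<open>
  In terms of the amplifier powers $x_m = \Psi(p_m) \in [0, P_{\max}]$ the received power is
  $\sum x_m^2\kappa_m^2$, respectively $(\sum x_m\kappa_m)^2$, so in both modes the rate constraint
  reads $\sum f(x_m) f(\kappa_m) \ge q$ with $f$ convex and increasing. By convexity, vectors
  with $\sum x_m \le n P_{\max} + y$ satisfy $\sum f(x_m) \le n f(P_{\max}) + f(y)$, and comparing
  all weights with that of the critical subarray turns this into a bound on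
  $\sum f(x_m) f(\kappa_m)$. It shows that a feasible vector can have neither a smaller
  $\sum x_m$ nor fewer active subarrays than $p^*$. As $p^*$ attains the target rate with
  equality, each of the terms of the energy is minimal at $p^*$.
\<close>

section \<open>A common form of the two beamforming modes\<close>

fun bf_term :: "bf_mode \<Rightarrow> real \<Rightarrow> real" where
  "bf_term Noncoherent x = x\<^sup>2"
| "bf_term Coherent x = x"

text \<open>The scale on which subarray contributions add up: in the coherent mode the square root
  of the received power, not the power itself, is a sum.\<close>

fun bf_level :: "bf_mode \<Rightarrow> real \<Rightarrow> real" where
  "bf_level Noncoherent s = s"
| "bf_level Coherent s = sqrt s"

lemma bf_term_0 [simp]: "bf_term b 0 = 0"
  by (cases b) auto

lemma bf_term_nonneg: "0 \<le> x \<Longrightarrow> 0 \<le> bf_term b x"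
  by (cases b) auto

lemma bf_term_pos: "0 < x \<Longrightarrow> 0 < bf_term b x"
  by (cases b) auto

lemma bf_term_le_iff: "0 \<le> x \<Longrightarrow> 0 \<le> y \<Longrightarrow> bf_term b x \<le> bf_term b y \<longleftrightarrow> x \<le> y"
  by (cases b) (auto simp: power_mono_iff)

lemma bf_level_le_iff: "bf_level b s \<le> bf_level b s' \<longleftrightarrow> s \<le> s'"
  by (cases b) auto

lemma bf_level_eq_iff: "bf_level b s = bf_level b s' \<longleftrightarrow> s = s'"
  by (cases b) auto

lemma bf_term_mult: "bf_term b x * bf_term b y = bf_term b (x * y)"
  by (cases b) (auto simp: power_mult_distrib)

section \<open>Convexity and sums under a budget\<close>

lemma bf_term_spread:
  assumes "a + a' = c + d" "c \<le> a" "a \<le> d"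
  shows "bf_term b a + bf_term b a' \<le> bf_term b c + bf_term b d"
proof (cases b)
  case Noncoherent
  have a': "a' = c + d - a" using assms(1) by simp
  \<comment> \<open>This is exactly the amount by which the outer pair \<open>c\<close>,
    \<open>d\<close> exceeds the inner pair \<open>a\<close>, \<open>a'\<close> in sum of
    squares.\<close>
  have "0 \<le> 2 * ((a - c) * (d - a))" using assms by simp
  also have "\<dots> = c\<^sup>2 + d\<^sup>2 - (a\<^sup>2 + a'\<^sup>2)"
    unfolding a' by (simp add: power2_eq_square algebra_simps)
  finally show ?thesis using Noncoherent by simp
qed (use assms in auto)

text \<open>A convex function vanishing at 0 gains from concentrating the budget. The induction
  removes one entry \<open>x j\<close> and pays for it from \<open>y\<close> if it fits there,
  otherwise from one of the full \<open>P\<close>; \<open>bf_term_spread\<close> bounds each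
  exchange.\<close>

lemma sum_bf_term_le:
  assumes "finite I" "\<forall>i\<in>I. 0 \<le> x i \<and> x i \<le> P" "0 \<le> y" "y \<le> P"
    and "(\<Sum>i\<in>I. x i) \<le> real n * P + y"
  shows "(\<Sum>i\<in>I. bf_term b (x i)) \<le> real n * bf_term b P + bf_term b y"
  using assms
proof (induction I arbitrary: n y rule: finite_induct)
  case empty
  then show ?case by (simp add: bf_term_nonneg)
next
  case (insert j I)
  have xj: "0 \<le> x j" "x j \<le> P" using insert.prems by auto
  have nn: "0 \<le> (\<Sum>i\<in>I. x i)" using insert.prems by (intro sum_nonneg) auto
  show ?case
  proof (cases "x j \<le> y")
    case True
    have "(\<Sum>i\<in>I. bf_term b (x i)) \<le> real n * bf_term b P + bf_term b (y - x j)"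
      using insert.prems insert.hyps True xj by (intro insert.IH) auto
    moreover have "bf_term b (x j) + bf_term b (y - x j) \<le> bf_term b 0 + bf_term b y"
      using True xj by (intro bf_term_spread) auto
    ultimately show ?thesis using insert.hyps by simp
  next
    case False
    \<comment> \<open>An entry above \<open>y\<close> does not fit into a budget of \<open>y\<close>
      alone.\<close>
    have "n \<noteq> 0"
    proof
      assume "n = 0"
      then show False using insert.prems(4) insert.hyps nn False by simp
    qed
    then obtain n' where n': "n = Suc n'" by (cases n) auto
    \<comment> \<open>One full \<open>P\<close> is merged with \<open>y\<close> to pay for
      \<open>x j\<close>; the new remainder lies between 0 and \<open>P\<close> because
      \<open>y < x j\<close> and \<open>x j \<le> P\<close>.\<close>
    have "(\<Sum>i\<in>I. bf_term b (x i)) \<le> real n' * bf_term b P + bf_term b (P + y - x j)"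
      using insert.prems insert.hyps False xj n'
      by (intro insert.IH) (auto simp: algebra_simps)
    moreover have "bf_term b (x j) + bf_term b (P + y - x j) \<le> bf_term b y + bf_term b P"
      using False xj by (intro bf_term_spread) auto
    ultimately show ?thesis using insert.hyps n' by (simp add: algebra_simps)
  qed
qed

text \<open>Split each weight as \<open>(w i - w k) + w k\<close>. The differences are nonnegative
  before \<open>k\<close>, where \<open>x i\<close> is raised to \<open>P\<close>, and nonpositive
  from \<open>k\<close> on, where the terms are dropped. The common weight \<open>w k\<close> is
  covered by \<open>sum_bf_term_le\<close>, whose \<open>k - 1\<close> full terms restore the
  weights \<open>w i\<close> before \<open>k\<close>.\<close>

lemma weighted_sum_bf_term_le:
  fixes w x :: "nat \<Rightarrow> real"
  assumes k: "k \<in> {1..M}"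
    and w: "\<And>i j. i \<in> {1..M} \<Longrightarrow> j \<in> {1..M} \<Longrightarrow> i \<le> j \<Longrightarrow> w j \<le> w i" "0 \<le> w k"
    and x: "\<forall>i\<in>{1..M}. 0 \<le> x i \<and> x i \<le> P" and y: "0 \<le> y" "y \<le> P"
    and s: "(\<Sum>i\<in>{1..M}. x i) \<le> real (k - 1) * P + y"
  shows "(\<Sum>i\<in>{1..M}. bf_term b (x i) * w i)
    \<le> (\<Sum>i\<in>{1..<k}. bf_term b P * w i) + bf_term b y * w k"
proof -
  let ?f = "bf_term b"
  have split: "{1..M} = {1..<k} \<union> {k..M}" using k by auto
  have "(\<Sum>i\<in>{1..M}. ?f (x i) * (w i - w k))
      = (\<Sum>i\<in>{1..<k}. ?f (x i) * (w i - w k)) + (\<Sum>i\<in>{k..M}. ?f (x i) * (w i - w k))"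
    unfolding split by (rule sum.union_disjoint) auto
  also have "(\<Sum>i\<in>{1..<k}. ?f (x i) * (w i - w k)) \<le> (\<Sum>i\<in>{1..<k}. ?f P * (w i - w k))"
    using k x w y
    by (intro sum_mono mult_right_mono) (auto simp: bf_term_le_iff)
  also have "(\<Sum>i\<in>{k..M}. ?f (x i) * (w i - w k)) \<le> 0"
    using k x w by (intro sum_nonpos mult_nonneg_nonpos) (auto simp: bf_term_nonneg)
  finally have "(\<Sum>i\<in>{1..M}. ?f (x i) * (w i - w k)) \<le> (\<Sum>i\<in>{1..<k}. ?f P * (w i - w k))"
    by simp
  moreover have "(\<Sum>i\<in>{1..M}. ?f (x i)) * w k \<le> (real (k - 1) * ?f P + ?f y) * w k"
    using x y s w(2) by (intro mult_right_mono sum_bf_term_le) auto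
  ultimately show ?thesis
    by (simp add: algebra_simps sum_subtractf sum_distrib_left sum_distrib_right)
qed

section \<open>Crossing a level by prefix sums\<close>

lemma prefix_sum_critical_index:
  fixes c :: "nat \<Rightarrow> real"
  assumes pos: "\<And>m. m \<in> {1..M} \<Longrightarrow> 0 < c m" and q: "0 < q" "q \<le> (\<Sum>m\<in>{1..M}. c m)"
  shows "\<exists>!k. k \<in> {1..M} \<and> (\<Sum>m\<in>{1..<k}. c m) < q \<and> q \<le> (\<Sum>m\<in>{1..k}. c m)"
proof (rule ex_ex1I)
  define k where "k = (LEAST k. q \<le> (\<Sum>m\<in>{1..k}. c m))"
  have le: "q \<le> (\<Sum>m\<in>{1..k}. c m)" unfolding k_def using q(2) by (rule LeastI)
  have "k \<le> M" unfolding k_def using q(2) by (rule Least_le)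
  have "k \<noteq> 0" using le q(1) by (intro notI) simp
  \<comment> \<open>By minimality of \<open>k\<close>, the prefix that is one term shorter stays
    below \<open>q\<close>.\<close>
  have "\<not> q \<le> (\<Sum>m\<in>{1..k - 1}. c m)"
    using \<open>k \<noteq> 0\<close> not_less_Least[of "k - 1" "\<lambda>k. q \<le> (\<Sum>m\<in>{1..k}. c m)"]
    unfolding k_def[symmetric] by simp
  moreover have "{1..k - 1} = {1..<k}" using \<open>k \<noteq> 0\<close> by auto
  ultimately show "\<exists>k. k \<in> {1..M} \<and> (\<Sum>m\<in>{1..<k}. c m) < q \<and> q \<le> (\<Sum>m\<in>{1..k}. c m)"
    using le \<open>k \<le> M\<close> \<open>k \<noteq> 0\<close> by (intro exI[of _ k]) auto
next
  \<comment> \<open>For uniqueness: if \<open>i < j\<close>, the prefix through \<open>i\<close>,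
    which reaches \<open>q\<close>, is contained in the prefix strictly before \<open>j\<close>,
    which does not.\<close>
  have "\<not> i < j"
    if "q \<le> (\<Sum>m\<in>{1..i}. c m)" "j \<in> {1..M}" "(\<Sum>m\<in>{1..<j}. c m) < q" for i j
  proof
    assume "i < j"
    then have "(\<Sum>m\<in>{1..i}. c m) \<le> (\<Sum>m\<in>{1..<j}. c m)"
      using that(2) by (intro sum_mono2) (auto intro!: less_imp_le[OF pos])
    then show False using that by simp
  qed
  then show "k = l"
    if "k \<in> {1..M} \<and> (\<Sum>m\<in>{1..<k}. c m) < q \<and> q \<le> (\<Sum>m\<in>{1..k}. c m)"
      and "l \<in> {1..M} \<and> (\<Sum>m\<in>{1..<l}. c m) < q \<and> q \<le> (\<Sum>m\<in>{1..l}. c m)" for k l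
    using that by (meson linorder_neqE_nat)
qed

section \<open>Amplifier powers, received power and rate\<close>

context
  fixes A :: hybrid_array
  assumes valid: "valid_array A"
begin

lemma valid_array_pos:
  "0 < slot A" "0 < bandwidth A" "0 < noise_power A" "0 < target_rate A" "0 < power_max A"
  "0 < eff_max A" "0 \<le> rate_coeff A" "0 < power_idle A" "power_idle A \<le> power_base A"
  "1 \<le> num_sub A"
  "m \<in> subarrays A \<Longrightarrow> 0 < channel_gain A m"
  using valid by (auto simp: valid_array_def)

lemma eff_gain_pos: "m \<in> subarrays A \<Longrightarrow> 0 < eff_gain A m"
  by (simp add: eff_gain_def valid_array_pos)

lemma pa_power_0 [simp]: "pa_power A 0 = 0"
  by (simp add: pa_power_def)

lemma pa_power_nonneg: "0 \<le> x \<Longrightarrow> 0 \<le> pa_power A x"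
  using valid_array_pos by (simp add: pa_power_def)

lemma pa_power_full: "pa_power A (power_max A * (eff_max A)\<^sup>2) = power_max A"
proof -
  have "power_max A * (eff_max A)\<^sup>2 * power_max A = (power_max A * eff_max A)\<^sup>2"
    by (simp add: power2_eq_square)
  then show ?thesis using valid_array_pos(5,6) by (simp add: pa_power_def)
qed

text \<open>The scaling in \<open>eff_gain\<close> cancels that in \<open>pa_power\<close>, so
  amplifier powers can replace transmit powers as variables.\<close>

lemma pa_power_mult_eff_gain: "pa_power A x * eff_gain A m = sqrt x * channel_gain A m"
  using valid_array_pos(5,6) by (simp add: pa_power_def eff_gain_def real_sqrt_mult)

lemma bf_term_pa_power:
  assumes "0 \<le> x"
  shows "bf_term b (pa_power A x) * bf_term b (eff_gain A m) = (case b of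
    Noncoherent \<Rightarrow> x * (channel_gain A m)\<^sup>2 | Coherent \<Rightarrow> sqrt x * channel_gain A m)"
proof -
  have "bf_term b (pa_power A x) * bf_term b (eff_gain A m) = bf_term b (sqrt x * channel_gain A m)"
    by (simp add: bf_term_mult pa_power_mult_eff_gain)
  then show ?thesis using assms by (cases b) (auto simp: power_mult_distrib)
qed

lemma bf_level_received_power:
  assumes "\<forall>m\<in>subarrays A. 0 \<le> p m"
  shows "bf_level b (received_power A b p)
    = (\<Sum>m\<in>subarrays A. bf_term b (pa_power A (p m)) * bf_term b (eff_gain A m))"
proof -
  \<comment> \<open>In the coherent mode \<open>bf_level\<close> takes the root of a square, which
    returns the sum itself only if that is nonnegative.\<close>
  have "0 \<le> (\<Sum>m\<in>subarrays A. sqrt (p m) * channel_gain A m)"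
    using assms by (intro sum_nonneg mult_nonneg_nonneg less_imp_le[OF valid_array_pos(11)]) auto
  then show ?thesis using assms by (cases b) (simp_all add: bf_term_pa_power del: bf_term.simps)
qed

lemma received_power_nonneg:
  "\<forall>m\<in>subarrays A. 0 \<le> p m \<Longrightarrow> 0 \<le> received_power A b p"
  by (cases b) (simp_all add: sum_nonneg)

lemma theta_pos:
  assumes "0 < t"
  shows "0 < theta A t"
  using valid_array_pos assms by (simp add: theta_def)

text \<open>\<open>theta\<close> results from solving the rate constraint for the received
  power.\<close>

lemma avg_rate_ge_iff:
  assumes "0 < t" "0 \<le> received_power A b p"
  shows "target_rate A \<le> avg_rate A b p t \<longleftrightarrow> theta A t \<le> received_power A b p"
proof -
  let ?S = "received_power A b p" and ?e = "target_rate A * slot A / (t * bandwidth A)"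
  note pos = valid_array_pos
  have S: "0 < 1 + ?S / noise_power A" using assms pos(3) by (simp add: add_pos_nonneg)
  have "target_rate A \<le> avg_rate A b p t \<longleftrightarrow> ?e \<le> log 2 (1 + ?S / noise_power A)"
    using assms pos(1,2) by (simp add: avg_rate_def inst_rate_def field_simps)
  also have "\<dots> \<longleftrightarrow> 2 powr ?e \<le> 1 + ?S / noise_power A"
    using S by (simp add: le_log_iff)
  also have "\<dots> \<longleftrightarrow> theta A t \<le> ?S"
    using pos(3) by (simp add: theta_def field_simps)
  finally show ?thesis .
qed

text \<open>By \<open>inst_rate_ge\<close> this value is a lower bound for the rate of every
  feasible vector, so a received power of \<open>theta\<close> gives the least possible
  rate.\<close>

lemma inst_rate_theta:
  assumes "0 < t" "received_power A b p = theta A t"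
  shows "inst_rate A b p = target_rate A * slot A / t"
  using assms valid_array_pos(2,3) by (simp add: inst_rate_def theta_def log_powr)

lemma inst_rate_ge:
  assumes "0 < t" "feasible A b t p"
  shows "target_rate A * slot A / t \<le> inst_rate A b p"
  using assms valid_array_pos(1) by (simp add: feasible_def avg_rate_def field_simps)

text \<open>Expresses feasibility through amplifier powers, uniformly in the mode. If some entry is
  negative, both sides are false.\<close>

lemma feasible_iff:
  assumes "0 < t"
  shows "feasible A b t p \<longleftrightarrow>
    (\<forall>m\<in>subarrays A. 0 \<le> p m \<and> pa_power A (p m) \<le> power_max A) \<and>
    bf_level b (theta A t)
      \<le> (\<Sum>m\<in>subarrays A. bf_term b (pa_power A (p m)) * bf_term b (eff_gain A m))"
proof (cases "\<forall>m\<in>subarrays A. 0 \<le> p m")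
  case True
  then show ?thesis
    unfolding feasible_def bf_level_received_power[OF True, symmetric] bf_level_le_iff
    using avg_rate_ge_iff[OF assms received_power_nonneg[OF True]]
    by (auto simp: pa_power_nonneg)
qed (auto simp: feasible_def)

section \<open>Full power and the minimum duration\<close>

abbreviation full_power :: "nat \<Rightarrow> real" where
  "full_power \<equiv> \<lambda>_. power_max A * (eff_max A)\<^sup>2"

lemma full_power_nonneg: "0 \<le> full_power m"
  using valid_array_pos by simp

lemma received_power_le_full:
  assumes "feasible A b t p"
  shows "received_power A b p \<le> received_power A b full_power"
proof -
  have *: "\<forall>m\<in>subarrays A. 0 \<le> p m \<and> pa_power A (p m) \<le> power_max A"
    using assms by (auto simp: feasible_def)
  have "bf_level b (received_power A b p) \<le> bf_level b (received_power A b full_power)"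
    using * full_power_nonneg valid_array_pos(5)
    by (auto simp: bf_level_received_power pa_power_full bf_term_le_iff pa_power_nonneg
        intro!: sum_mono mult_right_mono bf_term_nonneg less_imp_le[OF eff_gain_pos])
  then show ?thesis by (simp add: bf_level_le_iff)
qed

text \<open>\<open>t_min\<close> is a least real number, so its value has to be identified: it is
  the duration \<open>t0\<close> at which full power exactly meets the target rate.\<close>

lemma t_min_le_imp:
  assumes "t_min A b \<le> t"
  shows "0 < t" "feasible A b t full_power"
proof -
  note pos = valid_array_pos
  let ?R = "inst_rate A b full_power"
  define t0 where "t0 = target_rate A * slot A / ?R"
  have "1 \<in> subarrays A" using pos(10) by (simp add: subarrays_def)
  then have "0 < (\<Sum>m\<in>subarrays A. bf_term b (power_max A) * bf_term b (eff_gain A m))"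
    using pos(5)
    by (intro sum_pos) (auto intro!: mult_pos_pos bf_term_pos eff_gain_pos simp: subarrays_def)
  then have "bf_level b (received_power A b full_power) > bf_level b 0"
    using full_power_nonneg
    by (subst bf_level_received_power) (cases b; auto simp: pa_power_full)+
  then have S: "0 < received_power A b full_power"
    by (meson bf_level_le_iff not_less)
  then have R: "0 < ?R" using pos(2,3) by (simp add: inst_rate_def zero_less_log_cancel_iff add_pos_pos)
  have t0: "0 < t0" using R pos by (simp add: t0_def)
  \<comment> \<open>For fixed powers the average rate is linear in the duration, hence the
    threshold.\<close>
  have full: "feasible A b s full_power \<longleftrightarrow> t0 \<le> s" for s
    using R pos(1) full_power_nonneg pa_power_full pos(5)
    by (auto simp: feasible_def avg_rate_def t0_def field_simps)
  have "t_min A b = t0"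
    unfolding t_min_def
  proof (rule Least_equality)
    show "0 < t0 \<and> (\<exists>p. feasible A b t0 p)" using t0 full by blast
    fix s assume s: "0 < s \<and> (\<exists>p. feasible A b s p)"
    then obtain p where p: "feasible A b s p" by blast
    \<comment> \<open>Full power receives at least as much as \<open>p\<close>, so it is feasible
      whenever some vector is.\<close>
    then have "theta A s \<le> received_power A b full_power"
      using s avg_rate_ge_iff[of s b p] received_power_nonneg[of p b] received_power_le_full[OF p]
      by (auto simp: feasible_def)
    then have "feasible A b s full_power"
      using s S avg_rate_ge_iff[of s b full_power] full_power_nonneg pa_power_full pos(5)
      by (simp add: feasible_def)
    then show "t0 \<le> s" using full by simp
  qed
  then show "0 < t" "feasible A b t full_power" using assms t0 full by auto
qed

section \<open>Decomposition and positivity of the energy\<close>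

lemma total_energy_eq:
  assumes "\<forall>m\<in>subarrays A. 0 \<le> p m"
  shows "total_energy A b p t =
    t * (\<Sum>m\<in>subarrays A. pa_power A (p m))
    + real (card (active_set A p)) * (t * (rate_coeff A * inst_rate A b p + power_base A - power_idle A))
    + real (num_sub A) * (power_idle A * slot A)"
proof -
  let ?c = "t * (rate_coeff A * inst_rate A b p + power_base A - power_idle A)"
  have fin: "finite (subarrays A)" by (simp add: subarrays_def)
  \<comment> \<open>Every subarray is charged the idle energy of the whole slot; \<open>?c\<close>
    is the surcharge for activation beyond the amplifier energy.\<close>
  have "total_energy A b p t = (\<Sum>m\<in>subarrays A.
      t * pa_power A (p m) + (of_bool (p m > 0) * ?c + power_idle A * slot A))"
    unfolding total_energy_def sum.distrib[symmetric]
  proof (intro sum.cong refl)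
    fix m assume m: "m \<in> subarrays A"
    \<comment> \<open>An inactive subarray has zero power, so its amplifier term vanishes and may
      stay in the sum.\<close>
    then have "p m = 0" if "\<not> 0 < p m" using assms that by force
    then show "of_bool (0 < p m) * (tx_power A b p m * t + power_idle A * (slot A - t))
        + (1 - of_bool (0 < p m)) * (power_idle A * slot A)
      = t * pa_power A (p m) + (of_bool (p m > 0) * ?c + power_idle A * slot A)"
      by (cases "0 < p m") (auto simp: tx_power_def algebra_simps)
  qed
  also have "\<dots> = t * (\<Sum>m\<in>subarrays A. pa_power A (p m))
      + (\<Sum>m\<in>subarrays A. of_bool (p m > 0)) * ?c + real (card (subarrays A)) * (power_idle A * slot A)"
    by (simp add: sum.distrib sum_distrib_left sum_distrib_right)
  also have "(\<Sum>m\<in>subarrays A. of_bool (p m > 0) :: real) = real (card (active_set A p))"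
    using fin by (simp add: active_set_def of_bool_def sum.If_cases Int_def)
  finally show ?thesis by (simp add: subarrays_def)
qed

text \<open>The assumption that the base power is at least the idle power enters here: activating a
  subarray never saves energy.\<close>

lemma activation_cost_nonneg:
  assumes "0 < t" "0 \<le> R"
  shows "0 \<le> t * (rate_coeff A * R + power_base A - power_idle A)"
proof -
  have "0 \<le> rate_coeff A * R" using assms(2) valid_array_pos(7) by simp
  then show ?thesis using assms(1) valid_array_pos(9) by simp
qed

text \<open>Lets the energy stand in a denominator; strictness comes from the idle energy.\<close>

lemma total_energy_pos:
  assumes "0 < t" "feasible A b t p"
  shows "0 < total_energy A b p t"
proof -
  note pos = valid_array_pos
  have p: "\<forall>m\<in>subarrays A. 0 \<le> p m" using assms(2) by (simp add: feasible_def)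
  have "0 \<le> target_rate A * slot A / t" using pos assms by simp
  then have R: "0 \<le> inst_rate A b p" using inst_rate_ge[OF assms] by linarith
  have "0 \<le> t * (rate_coeff A * inst_rate A b p + power_base A - power_idle A)"
    using assms(1) R by (rule activation_cost_nonneg)
  moreover have "0 \<le> (\<Sum>m\<in>subarrays A. pa_power A (p m))"
    using p by (intro sum_nonneg) (simp add: pa_power_nonneg)
  moreover have "0 < real (num_sub A) * (power_idle A * slot A)" using pos by simp
  ultimately show ?thesis unfolding total_energy_eq[OF p] using assms(1)
    by (intro add_nonneg_pos add_nonneg_nonneg mult_nonneg_nonneg[of t "sum _ _"]
        mult_nonneg_nonneg[of "real _"]) simp_all
qed

section \<open>The critical subarray and lower bounds for feasible vectors\<close>

lemma critical_index_iff:
  "critical_index A b t \<pi> k \<longleftrightarrow> k \<in> subarrays A \<and>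
    (\<Sum>m\<in>{1..<k}. bf_term b (power_max A) * bf_term b (eff_gain A (\<pi> m))) < bf_level b (theta A t) \<and>
    bf_level b (theta A t) \<le> (\<Sum>m\<in>{1..k}. bf_term b (power_max A) * bf_term b (eff_gain A (\<pi> m)))"
  by (cases b) auto

text \<open>The critical subarray supplies exactly what the full ones before it leave open; the
  strict inequality makes this remainder, and so its power, positive.\<close>

lemma bf_term_critical_power:
  assumes "k \<in> subarrays A" "\<pi> permutes subarrays A"
    and less: "(\<Sum>m\<in>{1..<k}. bf_term b (power_max A) * bf_term b (eff_gain A (\<pi> m)))
      < bf_level b (theta A t)"
  shows "0 < critical_power A b t \<pi> k"
    and "bf_term b (pa_power A (critical_power A b t \<pi> k)) * bf_term b (eff_gain A (\<pi> k))
      = bf_level b (theta A t)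
        - (\<Sum>m\<in>{1..<k}. bf_term b (power_max A) * bf_term b (eff_gain A (\<pi> m)))"
proof -
  let ?c = "critical_power A b t \<pi> k"
  have h: "0 < channel_gain A (\<pi> k)"
    using assms by (simp add: permutes_in_image valid_array_pos)
  show c: "0 < ?c" using less h by (cases b) auto
  have "(case b of Noncoherent \<Rightarrow> ?c * (channel_gain A (\<pi> k))\<^sup>2
        | Coherent \<Rightarrow> sqrt ?c * channel_gain A (\<pi> k))
      = bf_level b (theta A t)
        - (\<Sum>m\<in>{1..<k}. bf_term b (power_max A) * bf_term b (eff_gain A (\<pi> m)))"
    using h less by (cases b) (auto simp: real_sqrt_divide)
  then show "bf_term b (pa_power A ?c) * bf_term b (eff_gain A (\<pi> k)) = \<dots>"
    using bf_term_pa_power[of ?c b "\<pi> k"] c by simp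
qed

text \<open>\<open>weighted_sum_bf_term_le\<close> after reindexing by \<open>\<pi>\<close>, with
  the sorted effective gains as weights. Both lower bounds below arise from a budget too small to
  reach the level.\<close>

lemma sorted_sum_bf_term_le:
  assumes "sorting_perm A \<pi>" "k \<in> subarrays A" "feasible A b t p" "0 < t"
    and y: "0 \<le> y" "y \<le> power_max A"
    and s: "(\<Sum>m\<in>subarrays A. pa_power A (p m)) \<le> real (k - 1) * power_max A + y"
  shows "bf_level b (theta A t)
    \<le> (\<Sum>m\<in>{1..<k}. bf_term b (power_max A) * bf_term b (eff_gain A (\<pi> m)))
      + bf_term b y * bf_term b (eff_gain A (\<pi> k))"
proof -
  have perm: "\<pi> permutes subarrays A" using assms(1) by (simp add: sorting_perm_def)
  have inS: "\<pi> m \<in> subarrays A" if "m \<in> subarrays A" for m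
    using perm that by (simp add: permutes_in_image)
  have p: "0 \<le> p m" "pa_power A (p m) \<le> power_max A" if "m \<in> subarrays A" for m
    using assms(3) that by (auto simp: feasible_def)
  have "bf_level b (theta A t)
      \<le> (\<Sum>m\<in>subarrays A. bf_term b (pa_power A (p m)) * bf_term b (eff_gain A m))"
    using assms(3,4) feasible_iff by blast
  also have "\<dots> = (\<Sum>m\<in>{1..num_sub A}.
      bf_term b (pa_power A (p (\<pi> m))) * bf_term b (eff_gain A (\<pi> m)))"
    using sum.permute[OF perm, of "\<lambda>m. bf_term b (pa_power A (p m)) * bf_term b (eff_gain A m)"]
    by (simp add: o_def subarrays_def)
  also have "\<dots> \<le> (\<Sum>m\<in>{1..<k}. bf_term b (power_max A) * bf_term b (eff_gain A (\<pi> m)))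
      + bf_term b y * bf_term b (eff_gain A (\<pi> k))"
  proof (rule weighted_sum_bf_term_le[OF _ _ _ _ y])
    show "k \<in> {1..num_sub A}" using assms(2) by (simp add: subarrays_def)
    show "bf_term b (eff_gain A (\<pi> j)) \<le> bf_term b (eff_gain A (\<pi> i))"
      if "i \<in> {1..num_sub A}" "j \<in> {1..num_sub A}" "i \<le> j" for i j
      using that assms(1) inS
      by (simp add: bf_term_le_iff less_imp_le[OF eff_gain_pos] sorting_perm_def subarrays_def)
    show "0 \<le> bf_term b (eff_gain A (\<pi> k))"
      using assms(2) inS by (intro bf_term_nonneg less_imp_le[OF eff_gain_pos])
    show "\<forall>i\<in>{1..num_sub A}. 0 \<le> pa_power A (p (\<pi> i)) \<and> pa_power A (p (\<pi> i)) \<le> power_max A"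
      using inS p pa_power_nonneg by (simp add: subarrays_def)
    show "(\<Sum>i\<in>{1..num_sub A}. pa_power A (p (\<pi> i))) \<le> real (k - 1) * power_max A + y"
      using sum.permute[OF perm, of "\<lambda>m. pa_power A (p m)"] s by (simp add: o_def subarrays_def)
  qed
  finally show ?thesis .
qed

text \<open>Fewer than \<open>k\<close> active subarrays spend at most \<open>k - 1\<close> full
  amplifier powers. With remainder 0 the level is then bounded by the prefix before
  \<open>k\<close>, against the strict inequality in \<open>critical_index\<close>.\<close>

lemma card_active_set_ge:
  assumes "sorting_perm A \<pi>" "critical_index A b t \<pi> k" "feasible A b t p" "0 < t"
  shows "k \<le> card (active_set A p)"
proof (rule ccontr)
  assume less: "\<not> k \<le> card (active_set A p)"
  note k = assms(2)[unfolded critical_index_iff]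
  have p: "0 \<le> p m" "pa_power A (p m) \<le> power_max A" if "m \<in> subarrays A" for m
    using assms(3) that by (auto simp: feasible_def)
  have "(\<Sum>m\<in>subarrays A. pa_power A (p m)) = (\<Sum>m\<in>active_set A p. pa_power A (p m))"
    using p(1) by (intro sum.mono_neutral_right) (force simp: active_set_def subarrays_def)+
  also have "\<dots> \<le> real (card (active_set A p)) * power_max A"
    using p(2) by (intro sum_bounded_above) (auto simp: active_set_def)
  also have "\<dots> \<le> real (k - 1) * power_max A"
    using less valid_array_pos(5) by (intro mult_right_mono) auto
  finally have "(\<Sum>m\<in>subarrays A. pa_power A (p m)) \<le> real (k - 1) * power_max A + 0" by simp
  from sorted_sum_bf_term_le[OF assms(1) _ assms(3,4) _ _ this] k valid_array_pos(5)
  show False by auto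
qed

lemma sum_pa_power_ge:
  assumes "sorting_perm A \<pi>" "critical_index A b t \<pi> k" "feasible A b t p" "0 < t"
    and y: "y \<le> power_max A" "0 < y"
    and eq: "bf_term b y * bf_term b (eff_gain A (\<pi> k)) = bf_level b (theta A t)
        - (\<Sum>m\<in>{1..<k}. bf_term b (power_max A) * bf_term b (eff_gain A (\<pi> m)))"
  shows "real (k - 1) * power_max A + y \<le> (\<Sum>m\<in>subarrays A. pa_power A (p m))"
proof (rule ccontr)
  let ?s = "\<Sum>m\<in>subarrays A. pa_power A (p m)"
  note k = assms(2)[unfolded critical_index_iff]
  \<comment> \<open>The part of the total beyond \<open>k - 1\<close> full amplifiers, cut off at 0
    because the total may be smaller than that.\<close>
  define z where "z = max 0 (?s - real (k - 1) * power_max A)"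
  assume "\<not> real (k - 1) * power_max A + y \<le> ?s"
  then have z: "0 \<le> z" "z < y" "?s \<le> real (k - 1) * power_max A + z"
    using y by (auto simp: z_def)
  have "bf_term b y * bf_term b (eff_gain A (\<pi> k)) \<le> bf_term b z * bf_term b (eff_gain A (\<pi> k))"
    using sorted_sum_bf_term_le[OF assms(1) _ assms(3,4) z(1) _ z(3)] k y z(2) eq by simp
  moreover have "0 < bf_term b (eff_gain A (\<pi> k))"
    using assms(1) k
    by (intro bf_term_pos eff_gain_pos) (simp add: sorting_perm_def permutes_in_image)
  ultimately have "y \<le> z" using y z by (simp add: bf_term_le_iff)
  then show False using z by simp
qed

section \<open>Existence of the critical index and optimality of \<open>p_star\<close>\<close>

lemma ex1_critical_index:
  assumes "t_min A b \<le> t" "\<pi> permutes subarrays A"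
  shows "\<exists>!k. critical_index A b t \<pi> k"
  unfolding critical_index_iff subarrays_def
proof (rule prefix_sum_critical_index)
  let ?c = "\<lambda>m. bf_term b (power_max A) * bf_term b (eff_gain A m)"
  note t = t_min_le_imp[OF assms(1)]
  show "0 < ?c (\<pi> m)" if "m \<in> {1..num_sub A}" for m
    using that assms(2) permutes_in_image[OF assms(2), of m] valid_array_pos(5)
    by (auto intro!: mult_pos_pos bf_term_pos eff_gain_pos simp: subarrays_def)
  show "0 < bf_level b (theta A t)" using theta_pos[OF t(1)] by (cases b) auto
  \<comment> \<open>Full power is feasible at \<open>t\<close>, so all subarrays together reach the
    level.\<close>
  have "bf_level b (theta A t) \<le> (\<Sum>m\<in>subarrays A. ?c m)"
    using t by (simp add: feasible_iff pa_power_full)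
  then show "bf_level b (theta A t) \<le> (\<Sum>m\<in>{1..num_sub A}. ?c (\<pi> m))"
    using sum.permute[OF assms(2), of ?c] by (simp add: o_def subarrays_def)
qed

lemma p_star_properties:
  assumes "0 < t" "sorting_perm A \<pi>" "critical_index A b t \<pi> k"
  defines "p \<equiv> p_star A b t \<pi> k" and "y \<equiv> pa_power A (critical_power A b t \<pi> k)"
  shows "active_set A p = \<pi> ` {1..k}"
    and "feasible A b t p"
    and "received_power A b p = theta A t"
    and "(\<Sum>m\<in>subarrays A. pa_power A (p m)) = real (k - 1) * power_max A + y"
    and "0 < y" "y \<le> power_max A"
proof -
  note k = assms(3)[unfolded critical_index_iff]
  let ?M = "num_sub A" and ?P = "power_max A"
  let ?w = "\<lambda>m. bf_term b (eff_gain A (\<pi> m))"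
  have perm: "\<pi> permutes subarrays A" using assms(2) by (simp add: sorting_perm_def)
  have kS: "k \<in> {1..?M}" using k by (simp add: subarrays_def)
  note pos = valid_array_pos
  have c: "0 < critical_power A b t \<pi> k"
    and yw: "bf_term b y * ?w k = bf_level b (theta A t) - (\<Sum>m\<in>{1..<k}. bf_term b ?P * ?w m)"
    using k bf_term_critical_power[OF _ perm, of k b t] by (simp_all add: y_def)
  have pp: "p (\<pi> m) = (if m < k then ?P * (eff_max A)\<^sup>2
      else if m = k then critical_power A b t \<pi> k else 0)" for m
    using perm by (simp add: p_def p_star_def Let_def permutes_inverses)
  have ppa: "pa_power A (p (\<pi> m)) = (if m < k then ?P else if m = k then y else 0)" for m
    by (simp add: pp pa_power_full y_def)
  have wk: "0 < ?w k"
    using k by (intro bf_term_pos eff_gain_pos) (simp add: permutes_in_image[OF perm])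
  show y0: "0 < y" using c pos(5,6) by (simp add: y_def pa_power_def)
  \<comment> \<open>The upper inequality of \<open>critical_index\<close> says that subarray
    \<open>\<pi> k\<close> at its limit covers the remainder, hence \<open>y\<close> respects the
    limit.\<close>
  have "{1..k} = insert k {1..<k}" using kS by auto
  then have "bf_term b y * ?w k \<le> bf_term b ?P * ?w k" using k yw by simp
  then show yP: "y \<le> ?P" using wk y0 pos(5) by (simp add: bf_term_le_iff)
  have img: "\<pi> ` subarrays A = subarrays A" using perm by (rule permutes_image)
  have ball: "(\<forall>m\<in>subarrays A. Q m) \<longleftrightarrow> (\<forall>m\<in>subarrays A. Q (\<pi> m))" for Q
    by (subst img[symmetric]) simp
  have act: "0 < p (\<pi> m) \<longleftrightarrow> m \<le> k" for m using c pos(5,6) by (auto simp: pp)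
  have "active_set A p = {m \<in> \<pi> ` subarrays A. 0 < p m}" by (simp add: active_set_def img)
  also have "\<dots> = \<pi> ` {m \<in> subarrays A. m \<le> k}" using act by auto
  also have "{m \<in> subarrays A. m \<le> k} = {1..k}" using kS by (auto simp: subarrays_def)
  finally show "active_set A p = \<pi> ` {1..k}" .
  have p0: "\<forall>m\<in>subarrays A. 0 \<le> p m"
    using c pos(5) by (subst ball) (auto simp: pp)
  \<comment> \<open>Used twice: with \<open>g\<close> the plain amplifier power for the total, and
    with \<open>g\<close> the weighted contribution for the received level.\<close>
  have split: "(\<Sum>m\<in>subarrays A. g m (pa_power A (p m))) =
      (\<Sum>m\<in>{1..<k}. g (\<pi> m) ?P) + g (\<pi> k) y" if "\<And>m. g m 0 = 0" for g :: "nat \<Rightarrow> real \<Rightarrow> real"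
  proof -
    have "(\<Sum>m\<in>subarrays A. g m (pa_power A (p m))) = (\<Sum>m\<in>{1..?M}. g (\<pi> m) (pa_power A (p (\<pi> m))))"
      using sum.permute[OF perm, of "\<lambda>m. g m (pa_power A (p m))"] by (simp add: o_def subarrays_def)
    also have "\<dots> = (\<Sum>m\<in>insert k {1..<k}. g (\<pi> m) (pa_power A (p (\<pi> m))))"
      using kS that by (intro sum.mono_neutral_right) (auto simp: ppa)
    also have "\<dots> = (\<Sum>m\<in>{1..<k}. g (\<pi> m) ?P) + g (\<pi> k) y"
      by (simp add: ppa)
    finally show ?thesis .
  qed
  show "(\<Sum>m\<in>subarrays A. pa_power A (p m)) = real (k - 1) * ?P + y"
    using split[of "\<lambda>_ x. x"] by simp
  have lev: "(\<Sum>m\<in>subarrays A. bf_term b (pa_power A (p m)) * bf_term b (eff_gain A m))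
      = bf_level b (theta A t)"
    using split[of "\<lambda>m x. bf_term b x * bf_term b (eff_gain A m)"] yw by simp
  then show "received_power A b p = theta A t"
    using bf_level_received_power[OF p0, of b] by (simp add: bf_level_eq_iff)
  have "\<forall>m\<in>subarrays A. pa_power A (p m) \<le> ?P"
    using yP pos(5) by (subst ball) (auto simp: ppa)
  then show "feasible A b t p" using p0 lev assms(1) by (simp add: feasible_iff)
qed

text \<open>In \<open>total_energy_eq\<close> the idle term is common to both vectors,
  \<open>sum_pa_power_ge\<close> compares the amplifier terms, and in the activation term both the
  count and the nonnegative unit cost are smallest at \<open>p_star\<close>.\<close>

lemma total_energy_p_star_le:
  assumes "0 < t" "sorting_perm A \<pi>" "critical_index A b t \<pi> k" "feasible A b t p"
  shows "total_energy A b (p_star A b t \<pi> k) t \<le> total_energy A b p t"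
proof -
  note pos = valid_array_pos
  let ?q = "p_star A b t \<pi> k"
  note star = p_star_properties[OF assms(1-3)]
  note k = assms(3)[unfolded critical_index_iff]
  have perm: "\<pi> permutes subarrays A" using assms(2) by (simp add: sorting_perm_def)
  have p0: "\<forall>m\<in>subarrays A. 0 \<le> p m" and q0: "\<forall>m\<in>subarrays A. 0 \<le> ?q m"
    using assms(4) star(2) by (auto simp: feasible_def)
  have card: "card (active_set A ?q) = k"
    unfolding star(1) by (subst card_image) (auto intro: inj_on_subset[OF permutes_inj[OF perm]])
  have R: "inst_rate A b ?q \<le> inst_rate A b p"
    using inst_rate_ge[OF assms(1,4)] inst_rate_theta[OF assms(1) star(3)] by simp
  have R0: "0 \<le> inst_rate A b ?q"
    using inst_rate_theta[OF assms(1) star(3)] pos assms(1) by simp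
  let ?c = "\<lambda>p. t * (rate_coeff A * inst_rate A b p + power_base A - power_idle A)"
  have c: "?c ?q \<le> ?c p" using R assms(1) pos(7) by (simp add: mult_left_mono)
  have c0: "0 \<le> ?c ?q"
    using assms(1) R0 by (rule activation_cost_nonneg)
  have "real (card (active_set A ?q)) * ?c ?q \<le> real (card (active_set A p)) * ?c p"
    using card_active_set_ge[OF assms(2-4,1)] c c0
    by (intro mult_mono[of "real _"]) (simp_all only: card of_nat_le_iff of_nat_0_le_iff)
  moreover have "(\<Sum>m\<in>subarrays A. pa_power A (?q m)) \<le> (\<Sum>m\<in>subarrays A. pa_power A (p m))"
    unfolding star(4)
    using k by (intro sum_pa_power_ge[OF assms(2-4,1) star(6,5)] bf_term_critical_power(2)) (auto intro: perm)
  ultimately show ?thesis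
    unfolding total_energy_eq[OF p0] total_energy_eq[OF q0] using assms(1)
    by (intro add_mono mult_left_mono[of "sum _ _"]) simp_all
qed

end

theorem theorem1:
  fixes A :: hybrid_array and b :: bf_mode and t :: real and \<pi> :: "nat \<Rightarrow> nat"
  assumes "valid_array A"
    and "t_min A b \<le> t" and "t \<le> slot A"
    and "sorting_perm A \<pi>"
  shows "(\<exists>!k. critical_index A b t \<pi> k) \<and>
    (\<forall>k. critical_index A b t \<pi> k \<longrightarrow>
       active_set A (p_star A b t \<pi> k) = \<pi> ` {1..k} \<and>
       feasible A b t (p_star A b t \<pi> k) \<and>
       (\<forall>p. feasible A b t p \<longrightarrow>
          total_energy A b (p_star A b t \<pi> k) t \<le> total_energy A b p t \<and>
          energy_efficiency A b p t \<le> energy_efficiency A b (p_star A b t \<pi> k) t))"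
proof (intro conjI allI impI)
  note t = t_min_le_imp[OF assms(1,2)]
  show "\<exists>!k. critical_index A b t \<pi> k"
    using ex1_critical_index assms by (simp add: sorting_perm_def)
  fix k assume k: "critical_index A b t \<pi> k"
  let ?q = "p_star A b t \<pi> k"
  note star = p_star_properties[OF assms(1) t(1) assms(4) k]
  show "active_set A ?q = \<pi> ` {1..k}" and "feasible A b t ?q" by (rule star)+
  fix p assume p: "feasible A b t p"
  show le: "total_energy A b ?q t \<le> total_energy A b p t"
    by (rule total_energy_p_star_le[OF assms(1) t(1) assms(4) k p])
  \<comment> \<open>Efficiency is a positive constant over energy, and both energies are positive
    because the smaller one is.\<close>
  show "energy_efficiency A b p t \<le> energy_efficiency A b ?q t"
    unfolding energy_efficiency_def
    using le total_energy_pos[OF assms(1) t(1) star(2)] valid_array_pos(1,4)[OF assms(1)]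
    by (intro divide_left_mono) auto
qed

end
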